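(* Let $L\in\mathbb{R}^{n\times n}$ be a Laplacian matrix and consider the linear system $\dot x=-Lx$. The following two properties are equivalent: (i) for any $x(0)\in\mathbb{R}^n\setminus\{0\}$ and any $t\ge 0$ there exists an index $i\in\{1,\dots,n\}$ (that may depend on $x(0)$ and $t$) such that the solution $x(t)$ satisfies $x_i(t)x_i(0)>0$; (ii) $L$ is an EP-matrix.
   Context: A matrix in $\mathbb{R}^{n\times n}$ is called a P-matrix if all its principal minors are positive. A matrix $A\in\mathbb{R}^{n\times n}$ is called an EP-matrix (exponential P-matrix) if $\exp(At)$ is a P-matrix for all $t\ge 0$. A Laplacian matrix is the Laplacian of a (possibly directed, weighted) graph on $n$ vertices, i.e., a real $n\times n$ matrix with non-positive off-diagonal entries and zero row sums; it need not be symmetric. *)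

theory Defs
  imports "HOL-Analysis.Analysis"
begin

text \<open>
  The type \<^typ>\<open>real ^ 'n ^ 'n\<close> carries the componentwise product, so \<^term>\<open>A ^ k\<close> is not the matrix
  power and the library's \<^const>\<open>exp\<close> is not available; the exponential series is built from the
  matrix product.
\<close>

definition mat_exp :: "real ^ 'n ^ 'n \<Rightarrow> real ^ 'n ^ 'n" where
  "mat_exp A = (\<Sum>k. (1 / fact k) *\<^sub>R ((**) A ^^ k) (mat 1))"

lemma sums_mat_exp:
  fixes A :: "real ^ 'n ^ 'n"
  shows "(\<lambda>k. (1 / fact k) *\<^sub>R ((**) A ^^ k) (mat 1)) sums mat_exp A"
proof -
  have "linear (\<lambda>X :: real ^ 'n ^ 'n. A ** X)"
    by (rule linearI)
       (simp_all add: vec_eq_iff matrix_matrix_mult_def sum_distrib_left sum.distrib algebra_simps)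
  then obtain K where "K > 0" and K: "\<And>X :: real ^ 'n ^ 'n. norm (A ** X) \<le> K * norm X"
    using linear_bounded_pos by blast
  have le: "norm (((**) A ^^ k) (mat 1)) \<le> K ^ k * norm (mat 1 :: real ^ 'n ^ 'n)" for k
  proof (induction k)
    case (Suc k)
    have "norm (((**) A ^^ Suc k) (mat 1)) \<le> K * norm (((**) A ^^ k) (mat 1))"
      using K by simp
    also have "\<dots> \<le> K * (K ^ k * norm (mat 1 :: real ^ 'n ^ 'n))"
      using Suc \<open>K > 0\<close> by (intro mult_left_mono) auto
    finally show ?case by (simp add: mult.assoc)
  qed simp
  have "summable (\<lambda>k. (inverse (fact k) * K ^ k) * norm (mat 1 :: real ^ 'n ^ 'n))"
    by (intro summable_mult2 summable_exp)
  then have "summable (\<lambda>k. (1 / fact k) *\<^sub>R ((**) A ^^ k) (mat 1))"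
    by (rule summable_comparison_test[rotated])
       (use le in \<open>auto simp: divide_simps mult_ac\<close>)
  then show ?thesis
    unfolding mat_exp_def by (rule summable_sums)
qed

text \<open>
  The determinant of the submatrix of \<^term>\<open>A\<close> with rows and columns in \<^term>\<open>S\<close>, by the formula that
  defines \<^const>\<open>det\<close>; the index set of \<^const>\<open>det\<close> is a type, so it cannot be applied to a set-indexed
  submatrix directly. The lemma below gives the agreement.
\<close>

definition principal_minor :: "real ^ 'n ^ 'n \<Rightarrow> 'n set \<Rightarrow> real" where
  "principal_minor A S = (\<Sum>p | p permutes S. of_int (sign p) * (\<Prod>i\<in>S. A $ i $ p i))"

lemma principal_minor_range:
  fixes A :: "real ^ 'n ^ 'n" and f :: "'m::finite \<Rightarrow> 'n"
  assumes "inj f"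
  shows "principal_minor A (range f) = det (\<chi> i j. A $ f i $ f j)"
proof -
  have bij: "bij_betw f UNIV (range f)"
    using assms by (simp add: bij_betw_def)
  have inv: "bij_betw (inv f) (range f) UNIV"
    using bij by (rule bij_betw_inv_into)
  show ?thesis
    unfolding principal_minor_def det_def
  proof (rule sum.reindex_bij_witness
      [where i = "map_permutation UNIV f" and j = "map_permutation (range f) (inv f)"])
    fix p assume "p \<in> {p. p permutes range f}"
    then have p: "p permutes range f" by simp
    let ?q = "map_permutation (range f) (inv f) p"
    show pq: "map_permutation UNIV f ?q = p"
      using inv p by (rule map_permutation_compose_inv) (auto intro: f_inv_into_f)
    show "?q \<in> {q. q permutes UNIV}"
      using map_permutation_permutes[OF inv p] by simp
    have q: "p (f i) = f (?q i)" for i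
      using map_permutation_apply[of f UNIV i ?q] assms pq by simp
    have "sign ?q = sign p"
      using inv p by (intro sign_map_permutation) (auto simp: bij_betw_def)
    moreover have "(\<Prod>i\<in>range f. A $ i $ p i) = (\<Prod>i\<in>UNIV. A $ f i $ f (?q i))"
      using assms by (simp add: prod.reindex q)
    ultimately show "of_int (sign ?q) * (\<Prod>i\<in>UNIV. (\<chi> i j. A $ f i $ f j) $ i $ ?q i) =
        of_int (sign p) * (\<Prod>i\<in>range f. A $ i $ p i)"
      by simp
  next
    fix q assume "q \<in> {q. q permutes (UNIV :: 'm set)}"
    then have q: "q permutes UNIV" by simp
    show "map_permutation (range f) (inv f) (map_permutation UNIV f q) = q"
      using bij q by (rule map_permutation_compose_inv) (simp add: assms)
    show "map_permutation UNIV f q \<in> {p. p permutes range f}"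
      using map_permutation_permutes[OF bij q] by simp
  qed
qed

definition P_matrix :: "real ^ 'n ^ 'n \<Rightarrow> bool" where
  "P_matrix A \<longleftrightarrow> (\<forall>S. S \<noteq> {} \<longrightarrow> principal_minor A S > 0)"

definition EP_matrix :: "real ^ 'n ^ 'n \<Rightarrow> bool" where
  "EP_matrix A \<longleftrightarrow> (\<forall>t\<ge>0. P_matrix (mat_exp (t *\<^sub>R A)))"

definition Laplacian_matrix :: "real ^ 'n ^ 'n \<Rightarrow> bool" where
  "Laplacian_matrix L \<longleftrightarrow>
     (\<forall>i j. i \<noteq> j \<longrightarrow> L $ i $ j \<le> 0) \<and> (\<forall>i. (\<Sum>j\<in>UNIV. L $ i $ j) = 0)"

definition Laplacian_flow :: "real ^ 'n ^ 'n \<Rightarrow> (real \<Rightarrow> real ^ 'n) \<Rightarrow> bool" where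
  "Laplacian_flow L x \<longleftrightarrow>
     (\<forall>t\<ge>0. (x has_vector_derivative - (L *v x t)) (at t within {0..}))"

end

theory Submission
  imports Defs
begin

text \<open>
  A flow satisfies \<open>x 0 = exp (t L) x t\<close>, and \<open>exp (t L)\<close> is invertible, so the first property says
  that no \<open>exp (t L)\<close> with \<open>t \<ge> 0\<close> reverses the signs of a nonzero vector. By the theorem of Fiedler
  and Ptak the matrices without sign reversal are exactly the P-matrices.
\<close>

section \<open>P-matrices and sign reversal\<close>

lemma principal_minor_empty [simp]: "principal_minor A {} = 1"
  by (simp add: principal_minor_def)

text \<open>Padding the rows outside \<open>S\<close> with unit rows kills every permutation that
  moves an index outside \<open>S\<close> and adds only factors 1 to the others. Kernel and
  continuity arguments for \<open>det\<close> thus become available for minors.\<close>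

lemma principal_minor_eq_det:
  fixes A :: "real ^ 'n ^ 'n"
  shows "principal_minor A S = det (\<chi> i j. if i \<in> S then A $ i $ j else of_bool (i = j))"
  (is "_ = det ?B")
proof -
  have on_S: "(\<Prod>i\<in>UNIV. ?B $ i $ p i) = (\<Prod>i\<in>S. A $ i $ p i)" if "p permutes S" for p
    by (rule prod.mono_neutral_cong_right) (use that in \<open>auto simp: permutes_not_in\<close>)
  have off_S: "(\<Prod>i\<in>UNIV. ?B $ i $ p i) = 0" if "p permutes UNIV" "\<not> p permutes S" for p
  proof -
    have "\<exists>i. i \<notin> S \<and> p i \<noteq> i"
      using that(2) permutes_superset[OF that(1), of S] by blast
    then obtain i where "i \<notin> S" "p i \<noteq> i" by blast
    then show ?thesis by (intro prod_zero bexI[of _ i]) auto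
  qed
  have "principal_minor A S =
      (\<Sum>p | p permutes S. of_int (sign p) * (\<Prod>i\<in>UNIV. ?B $ i $ p i))"
    unfolding principal_minor_def by (intro sum.cong) (simp_all only: mem_Collect_eq on_S)
  also have "\<dots> = det ?B"
    unfolding det_def
  proof (rule sum.mono_neutral_left)
    show "\<forall>p\<in>{p. p permutes UNIV} - {p. p permutes S}.
        of_int (sign p) * (\<Prod>i\<in>UNIV. ?B $ i $ p i) = 0"
      using off_S by simp
  qed (auto simp: finite_permutations intro: permutes_subset)
  finally show ?thesis .
qed

text \<open>A minor is affine in each diagonal entry: only the permutations fixing \<open>k\<close>
  meet the entry at \<open>(k, k)\<close>, and they are the permutations of
  \<open>S - {k}\<close>.\<close>

lemma principal_minor_add_diagonal_entry:
  fixes A :: "real ^ 'n ^ 'n"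
  assumes "k \<in> S"
  shows "principal_minor (\<chi> i j. A $ i $ j + (if i = k \<and> j = k then d else 0)) S =
    principal_minor A S + d * principal_minor A (S - {k})"
  (is "principal_minor ?B S = _")
proof -
  have fin: "finite S" by simp
  have split: "(\<Prod>i\<in>S. ?B $ i $ p i) = (\<Prod>i\<in>S. A $ i $ p i) +
      (if p k = k then d * (\<Prod>i\<in>S - {k}. A $ i $ p i) else 0)" for p
  proof -
    have "(\<Prod>i\<in>S - {k}. ?B $ i $ p i) = (\<Prod>i\<in>S - {k}. A $ i $ p i)"
      by (rule prod.cong) auto
    then show ?thesis
      using prod.remove[OF fin assms, of "\<lambda>i. ?B $ i $ p i"]
        prod.remove[OF fin assms, of "\<lambda>i. A $ i $ p i"]
      by (simp add: algebra_simps)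
  qed
  have perms: "{p. p permutes S} \<inter> {p. p k = k} = {p. p permutes S - {k}}"
    by (auto intro: permutes_superset permutes_subset simp: permutes_not_in)
  have "principal_minor ?B S = principal_minor A S +
      (\<Sum>p | p permutes S. if p k = k
        then of_int (sign p) * (d * (\<Prod>i\<in>S - {k}. A $ i $ p i)) else 0)"
    unfolding principal_minor_def split sum.distrib[symmetric]
    by (intro sum.cong) (auto simp: algebra_simps)
  also have "(\<Sum>p | p permutes S. if p k = k
        then of_int (sign p) * (d * (\<Prod>i\<in>S - {k}. A $ i $ p i)) else 0) =
      (\<Sum>p | p permutes S - {k}. of_int (sign p) * (d * (\<Prod>i\<in>S - {k}. A $ i $ p i)))"
    by (subst perms[symmetric], subst sum.inter_restrict) (auto simp: finite_permutations)
  also have "\<dots> = d * principal_minor A (S - {k})"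
    by (simp add: principal_minor_def sum_distrib_left mult_ac)
  finally show ?thesis .
qed

lemma principal_minor_cong:
  assumes "\<And>i j. i \<in> S \<Longrightarrow> j \<in> S \<Longrightarrow> A $ i $ j = B $ i $ j"
  shows "principal_minor A S = principal_minor B S"
  unfolding principal_minor_def
  by (intro sum.cong prod.cong arg_cong2[where f = "(*)"])
    (use assms in \<open>auto simp: permutes_in_image\<close>)

lemma P_matrix_add_diagonal_entry:
  fixes A :: "real ^ 'n ^ 'n"
  assumes "P_matrix A" "d \<ge> 0"
  shows "P_matrix (\<chi> i j. A $ i $ j + (if i = k \<and> j = k then d else 0))"
  (is "P_matrix ?B")
  unfolding P_matrix_def
proof (intro allI impI)
  fix S :: "'n set" assume S: "S \<noteq> {}"
  \<comment> \<open>\<open>T\<close> may be empty, with minor 1; this covers \<open>S = {k}\<close>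
    in the expansion.\<close>
  have pos: "principal_minor A T > 0" for T
    using assms(1) by (cases "T = {}") (auto simp: P_matrix_def)
  show "principal_minor ?B S > 0"
  proof (cases "k \<in> S")
    case True
    have "d * principal_minor A (S - {k}) \<ge> 0"
      using assms(2) pos less_imp_le by (intro mult_nonneg_nonneg) auto
    then show ?thesis
      unfolding principal_minor_add_diagonal_entry[OF True] using pos[of S] by simp
  next
    case False
    then have "principal_minor ?B S = principal_minor A S"
      by (intro principal_minor_cong) auto
    then show ?thesis using pos by simp
  qed
qed

lemma P_matrix_add_diagonal:
  fixes A :: "real ^ 'n ^ 'n"
  assumes "P_matrix A" "\<And>i. d i \<ge> 0"
  shows "P_matrix (\<chi> i j. A $ i $ j + (if i = j then d i else 0))"
proof -
  \<comment> \<open>One entry is changed at a time; \<open>K\<close> collects the positions already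
    changed.\<close>
  have "P_matrix (\<chi> i j. A $ i $ j + (if i = j \<and> i \<in> K then d i else 0))" for K :: "'n set"
    using finite[of K]
  proof (induction K)
    case empty
    then show ?case using assms(1) by (simp add: vec_lambda_eta)
  next
    case (insert k K)
    have "(\<chi> i j. A $ i $ j + (if i = j \<and> i \<in> insert k K then d i else 0)) =
        (\<chi> i j. (\<chi> i j. A $ i $ j + (if i = j \<and> i \<in> K then d i else 0)) $ i $ j
          + (if i = k \<and> j = k then d k else 0))"
      using insert.hyps by (auto simp: vec_eq_iff)
    then show ?case
      using P_matrix_add_diagonal_entry[OF insert.IH assms(2)[of k], of k] by simp
  qed
  from this[of UNIV] show ?thesis by simp
qed

lemma det_eq_0_iff_kernel:
  fixes A :: "real ^ 'n ^ 'n"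
  shows "det A = 0 \<longleftrightarrow> (\<exists>x. x \<noteq> 0 \<and> A *v x = 0)"
  using invertible_det_nz[of A] matrix_left_invertible_ker[of A] invertible_left_inverse[of A]
  by blast

text \<open>One direction of the Fiedler-Ptak theorem. If no product
  \<open>x $ i * (A *v x) $ i\<close> were positive, a nonnegative diagonal shift could make the
  image of \<open>x\<close> vanish on the support of \<open>x\<close>. The shifted matrix would
  still be a P-matrix, yet have a singular principal submatrix.\<close>

lemma P_matrix_imp_no_sign_reversal:
  fixes A :: "real ^ 'n ^ 'n"
  assumes "P_matrix A" "x \<noteq> 0"
  shows "\<exists>i. x $ i * (A *v x) $ i > 0"
proof (rule ccontr)
  assume "\<not> ?thesis"
  then have neg: "x $ i * (A *v x) $ i \<le> 0" for i by (auto simp: not_less)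
  define S where "S = {i. x $ i \<noteq> 0}"
  \<comment> \<open>Off the support of \<open>x\<close> the quotient is 0.\<close>
  define d where "d i = - (x $ i * (A *v x) $ i) / (x $ i)\<^sup>2" for i
  define B where "B = (\<chi> i j. A $ i $ j + (if i = j then d i else 0))"
  have "P_matrix B"
    unfolding B_def using assms(1) neg by (intro P_matrix_add_diagonal) (auto simp: d_def divide_nonpos_nonneg)
  moreover have "S \<noteq> {}"
    using assms(2) by (auto simp: S_def vec_eq_iff)
  ultimately have "principal_minor B S > 0"
    by (simp add: P_matrix_def)
  \<comment> \<open>\<open>x\<close> itself is the kernel vector: on \<open>S\<close> the shift
    \<open>d\<close> cancels \<open>A *v x\<close>, and off \<open>S\<close> the unit row returns
    \<open>x $ i\<close>, which is 0.\<close>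
  moreover have "principal_minor B S = 0"
    unfolding principal_minor_eq_det det_eq_0_iff_kernel
  proof (intro exI[of _ x] conjI vec_eq_iff[THEN iffD2] allI)
    fix i
    have "(\<Sum>j\<in>UNIV. B $ i $ j * x $ j) = (A *v x) $ i + d i * x $ i"
      by (simp add: B_def matrix_vector_mult_def distrib_right sum.distrib
          if_distrib[of "\<lambda>c. c * _"] cong: if_cong)
    moreover have "(A *v x) $ i + d i * x $ i = 0" if "i \<in> S"
      using that by (simp add: d_def S_def power2_eq_square)
    ultimately show "((\<chi> i j. if i \<in> S then B $ i $ j else of_bool (i = j)) *v x) $ i = 0 $ i"
      by (cases "i \<in> S") (auto simp: matrix_vector_mult_def S_def of_bool_def if_distribR
          intro!: sum.neutral)
  qed (rule assms(2))
  ultimately show False by simp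
qed

text \<open>The converse direction. A kernel vector of a matrix on the homotopy would, at an index
  where \<open>A\<close> preserves its sign, write 0 as a convex combination of two positive
  numbers.\<close>

lemma no_sign_reversal_imp_P_matrix:
  fixes A :: "real ^ 'n ^ 'n"
  assumes "\<And>x. x \<noteq> 0 \<Longrightarrow> \<exists>i. x $ i * (A *v x) $ i > 0"
  shows "P_matrix A"
  unfolding P_matrix_def
proof (intro allI impI)
  fix S :: "'n set"
  \<comment> \<open>A homotopy through invertible matrices to the identity.\<close>
  define M where "M t = (\<chi> i j. (1 - t) * (if i \<in> S then A $ i $ j else of_bool (i = j))
    + t * of_bool (i = j))" for t :: real
  have M_vec: "(M t *v x) $ i = (1 - t) * (if i \<in> S then (A *v x) $ i else x $ i) + t * x $ i"
    for t x i
    by (simp add: M_def matrix_vector_mult_def distrib_right sum.distrib mult.assoc of_bool_def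
        if_distrib[of "\<lambda>c. c * _"] if_distrib[of "\<lambda>c. _ * c"] flip: sum_distrib_left
        cong: if_cong)
  have nz: "det (M t) \<noteq> 0" if t: "0 \<le> t" "t \<le> 1" for t
  proof
    assume "det (M t) = 0"
    then obtain x where x: "x \<noteq> 0" "M t *v x = 0"
      unfolding det_eq_0_iff_kernel by blast
    obtain i where i: "x $ i * (A *v x) $ i > 0"
      using assms[OF x(1)] by blast
    have eq: "(1 - t) * (if i \<in> S then (A *v x) $ i else x $ i) + t * x $ i = 0"
      using x(2) M_vec[of t x i] by simp
    \<comment> \<open>Outside \<open>S\<close> the equation collapses to \<open>x $ i = 0\<close>,
      which the choice of \<open>i\<close> excludes.\<close>
    have "i \<in> S"
      using eq i by (auto simp: algebra_simps split: if_splits)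
    with eq have "x $ i * ((1 - t) * (A *v x) $ i + t * x $ i) = 0"
      by simp
    then have "(1 - t) * (x $ i * (A *v x) $ i) + t * (x $ i * x $ i) = 0"
      by (simp add: distrib_left mult.left_commute)
    moreover have "x $ i * x $ i > 0"
      using i by (metis mult_zero_left not_real_square_gt_zero order_less_irrefl)
    \<comment> \<open>For \<open>t = 0\<close> the first summand is positive, for
      \<open>t > 0\<close> the second.\<close>
    then have "(1 - t) * (x $ i * (A *v x) $ i) + t * (x $ i * x $ i) > 0"
      using t i by (cases "t = 0") (simp_all add: add_nonneg_pos)
    ultimately show False by simp
  qed
  have "continuous_on {0..1} (\<lambda>t. det (M t))"
    unfolding det_def M_def by (auto intro!: continuous_intros)
  moreover have "det (M 1) = 1"
  proof -
    have "M 1 = mat 1" by (auto simp: M_def mat_def vec_eq_iff)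
    then show ?thesis by simp
  qed
  \<comment> \<open>By the intermediate value theorem, a nonpositive value at 0 would force a zero
    of the determinant on the way to the value 1.\<close>
  ultimately have "det (M 0) > 0"
    using IVT'[of "\<lambda>t. det (M t)" 0 0 1] nz by (force simp: not_less)
  then show "principal_minor A S > 0"
    by (simp add: principal_minor_eq_det M_def)
qed

section \<open>The matrix exponential\<close>

text \<open>Boundedness is automatic in finite dimension; it lets a matrix be multiplied into a
  convergent series term by term.\<close>

lemma bounded_bilinear_matrix_mul:
  "bounded_bilinear ((**) :: real ^ 'n ^ 'm \<Rightarrow> real ^ 'k ^ 'n \<Rightarrow> real ^ 'k ^ 'm)"
  unfolding bilinear_conv_bounded_bilinear[symmetric] bilinear_def
  by (intro conjI allI linearI)
    (simp_all add: vec_eq_iff matrix_matrix_mult_def sum_distrib_left sum.distrib algebra_simps)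

text \<open>Supplies the product rule for a matrix curve acting on a vector curve.\<close>

lemma bounded_bilinear_matrix_vector_mul:
  "bounded_bilinear ((*v) :: real ^ 'n ^ 'm \<Rightarrow> real ^ 'n \<Rightarrow> real ^ 'm)"
  unfolding bilinear_conv_bounded_bilinear[symmetric] bilinear_def
  by (intro conjI allI linearI)
    (simp_all add: vec_eq_iff matrix_vector_mult_def sum_distrib_left sum.distrib algebra_simps)

lemmas scaleR_matrix_mul =
  bounded_bilinear.scaleR_left[OF bounded_bilinear_matrix_mul]
  bounded_bilinear.scaleR_right[OF bounded_bilinear_matrix_mul]

text \<open>Turns the exponential series of \<open>t *\<^sub>R A\<close> into a power series in
  \<open>t\<close>.\<close>

lemma scaleR_matrix_funpow:
  fixes A :: "real ^ 'n ^ 'n"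
  shows "((**) (t *\<^sub>R A) ^^ k) (mat 1) = t ^ k *\<^sub>R ((**) A ^^ k) (mat 1)"
  by (induction k) (simp_all add: scaleR_matrix_mul mult.commute)

lemma matrix_funpow_commute:
  fixes A :: "real ^ 'n ^ 'n"
  shows "A ** ((**) A ^^ k) (mat 1) = ((**) A ^^ k) (mat 1) ** A"
proof (induction k)
  case (Suc k)
  then show ?case
    by (metis comp_apply funpow.simps(2) matrix_mul_assoc)
qed simp

lemma mat_exp_0 [simp]: "mat_exp (0 :: real ^ 'n ^ 'n) = mat 1"
proof -
  have "(\<lambda>k. (1 / fact k) *\<^sub>R ((**) (0 :: real ^ 'n ^ 'n) ^^ k) (mat 1)) sums
      (\<Sum>k\<in>{0}. (1 / fact k) *\<^sub>R ((**) (0 :: real ^ 'n ^ 'n) ^^ k) (mat 1))"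
  proof (rule sums_finite)
    fix k :: nat assume "k \<notin> {0}"
    then show "(1 / fact k) *\<^sub>R ((**) (0 :: real ^ 'n ^ 'n) ^^ k) (mat 1) = 0"
      by (cases k) auto
  qed simp
  then show ?thesis
    using sums_mat_exp sums_unique2 by fastforce
qed

lemma mat_exp_commute:
  fixes A :: "real ^ 'n ^ 'n"
  shows "A ** mat_exp (t *\<^sub>R A) = mat_exp (t *\<^sub>R A) ** A"
proof -
  let ?T = "\<lambda>k. (1 / fact k) *\<^sub>R ((**) (t *\<^sub>R A) ^^ k) (mat 1)"
  have "A ** ?T k = ?T k ** A" for k
    by (simp add: scaleR_matrix_funpow scaleR_matrix_mul matrix_funpow_commute)
  moreover have "(\<lambda>k. A ** ?T k) sums (A ** mat_exp (t *\<^sub>R A))"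
    by (rule bounded_linear.sums[OF
          bounded_bilinear.bounded_linear_right[OF bounded_bilinear_matrix_mul] sums_mat_exp])
  moreover have "(\<lambda>k. ?T k ** A) sums (mat_exp (t *\<^sub>R A) ** A)"
    by (rule bounded_linear.sums[OF
          bounded_bilinear.bounded_linear_left[OF bounded_bilinear_matrix_mul] sums_mat_exp])
  ultimately show ?thesis
    using sums_unique2 by fastforce
qed

lemma has_vector_derivative_vecI:
  fixes f :: "real \<Rightarrow> 'a::real_normed_vector ^ 'n"
  assumes "\<And>i. ((\<lambda>t. f t $ i) has_vector_derivative f' $ i) F"
  shows "(f has_vector_derivative f') F"
  using assms unfolding has_vector_derivative_def has_derivative_def
  by (auto intro!: vec_tendstoI bounded_linear_scaleR_left)

text \<open>Each entry is a scalar power series in \<open>t\<close> that converges everywhere, so it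
  may be differentiated term by term.\<close>

lemma has_vector_derivative_mat_exp:
  fixes A :: "real ^ 'n ^ 'n"
  shows "((\<lambda>t. mat_exp (t *\<^sub>R A)) has_vector_derivative A ** mat_exp (t *\<^sub>R A)) (at t within S)"
proof -
  have "((\<lambda>t. mat_exp (t *\<^sub>R A) $ i $ j) has_real_derivative (A ** mat_exp (t *\<^sub>R A)) $ i $ j) (at t)"
    for i j
  proof -
    define c where "c k = (1 / fact k) * ((**) A ^^ k) (mat 1) $ i $ j" for k
    have sums: "(\<lambda>k. c k * s ^ k) sums (mat_exp (s *\<^sub>R A) $ i $ j)" for s
    proof -
      have "(\<lambda>k. ((1 / fact k) *\<^sub>R ((**) (s *\<^sub>R A) ^^ k) (mat 1)) $ i $ j) sums
          (mat_exp (s *\<^sub>R A) $ i $ j)"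
        by (intro bounded_linear.sums[OF bounded_linear_vec_nth] sums_mat_exp)
      then show ?thesis by (simp add: c_def scaleR_matrix_funpow mult_ac)
    qed
    have "(\<lambda>k. (A ** ((1 / fact k) *\<^sub>R ((**) (t *\<^sub>R A) ^^ k) (mat 1))) $ i $ j) sums
        ((A ** mat_exp (t *\<^sub>R A)) $ i $ j)"
      by (intro bounded_linear.sums[OF bounded_linear_vec_nth] bounded_linear.sums[OF
          bounded_bilinear.bounded_linear_right[OF bounded_bilinear_matrix_mul]] sums_mat_exp)
    \<comment> \<open>The factor \<open>Suc k\<close> from \<open>diffs\<close> reduces
      \<open>fact (Suc k)\<close> to \<open>fact k\<close>; the surplus power of \<open>A\<close> is
      the \<open>A\<close> in front.\<close>
    moreover have "(A ** ((1 / fact k) *\<^sub>R ((**) (t *\<^sub>R A) ^^ k) (mat 1))) $ i $ j =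
        diffs c k * t ^ k" for k
      by (simp add: diffs_def c_def scaleR_matrix_funpow scaleR_matrix_mul divide_simps)
    ultimately have "(\<lambda>k. diffs c k * t ^ k) sums ((A ** mat_exp (t *\<^sub>R A)) $ i $ j)"
      by simp
    then show ?thesis
      using termdiffs_strong_converges_everywhere[of c t] sums
      by (simp add: sums_iff)
  qed
  then have "((\<lambda>t. mat_exp (t *\<^sub>R A)) has_vector_derivative A ** mat_exp (t *\<^sub>R A)) (at t)"
    by (intro has_vector_derivative_vecI)
      (simp add: has_real_derivative_iff_has_vector_derivative)
  then show ?thesis
    by (rule has_vector_derivative_at_within)
qed

section \<open>Solutions of the linear system\<close>

text \<open>The left-hand side is constant in time: the two terms of the product rule cancel because
  \<open>L\<close> commutes with its exponential.\<close>

lemma mat_exp_flow_eq_initial_value: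
  fixes L :: "real ^ 'n ^ 'n"
  assumes "Laplacian_flow L x" "t \<ge> 0"
  shows "mat_exp (t *\<^sub>R L) *v x t = x 0"
proof -
  have "((\<lambda>s. mat_exp (s *\<^sub>R L) *v x s) has_vector_derivative 0) (at s within {0..})"
    if "s \<in> {0..}" for s
  proof -
    have "((\<lambda>s. mat_exp (s *\<^sub>R L) *v x s) has_vector_derivative
        mat_exp (s *\<^sub>R L) *v - (L *v x s) + (L ** mat_exp (s *\<^sub>R L)) *v x s) (at s within {0..})"
      using assms(1) that
      by (intro bounded_bilinear.has_vector_derivative[OF bounded_bilinear_matrix_vector_mul]
          has_vector_derivative_mat_exp) (auto simp: Laplacian_flow_def)
    then show ?thesis
      by (simp add: mat_exp_commute matrix_vector_mul_assoc
          bounded_bilinear.minus_right[OF bounded_bilinear_matrix_vector_mul])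
  qed
  then obtain c where c: "mat_exp (s *\<^sub>R L) *v x s = c" if "s \<in> {0..}" for s
    using has_vector_derivative_zero_constant[OF convex_real_interval(1)[of 0]] by blast
  show ?thesis
    using c[of t] c[of 0] assms(2) by simp
qed

text \<open>The shift by \<open>t\<close> makes this the solution that arrives at \<open>y\<close>
  at time \<open>t\<close>, having started from \<open>mat_exp (t *\<^sub>R L) *v y\<close>.\<close>

lemma Laplacian_flow_mat_exp:
  fixes L :: "real ^ 'n ^ 'n"
  shows "Laplacian_flow L (\<lambda>s. mat_exp ((t - s) *\<^sub>R L) *v y)"
  unfolding Laplacian_flow_def
proof (intro allI impI)
  fix s :: real
  have "((\<lambda>s. mat_exp ((t - s) *\<^sub>R L)) has_vector_derivative
      (- 1) *\<^sub>R (L ** mat_exp ((t - s) *\<^sub>R L))) (at s within {0..})"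
  proof -
    have "((\<lambda>s. t - s) has_vector_derivative - 1) (at s within {0..})"
      by (auto intro!: derivative_eq_intros)
    from vector_diff_chain_within[OF this has_vector_derivative_mat_exp[of L]]
    show ?thesis by (simp add: o_def)
  qed
  then show "((\<lambda>s. mat_exp ((t - s) *\<^sub>R L) *v y) has_vector_derivative
      - (L *v (mat_exp ((t - s) *\<^sub>R L) *v y))) (at s within {0..})"
    by (auto dest!: bounded_linear.has_vector_derivative[OF
          bounded_bilinear.bounded_linear_left[OF bounded_bilinear_matrix_vector_mul], of _ _ _ y]
        simp: matrix_vector_mul_assoc bounded_bilinear.minus_left[OF bounded_bilinear_matrix_vector_mul])
qed

text \<open>The curve \<open>mat_exp (s *\<^sub>R A) *v y\<close> solves the system of
  \<open>- A\<close>, so carrying it back from time \<open>t\<close> recovers \<open>y\<close>. This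
  yields injectivity of the exponential without its addition theorem.\<close>

lemma mat_exp_mult_vector_inverse:
  fixes A :: "real ^ 'n ^ 'n"
  assumes "t \<ge> 0"
  shows "mat_exp (t *\<^sub>R (- A)) *v (mat_exp (t *\<^sub>R A) *v y) = y"
  using mat_exp_flow_eq_initial_value[OF Laplacian_flow_mat_exp[of "- A" 0 y] assms] by simp

theorem proposition4:
  fixes L :: "real ^ 'n ^ 'n"
  assumes "Laplacian_matrix L"
  shows "(\<forall>x0. x0 \<noteq> 0 \<longrightarrow>
            (\<forall>x. Laplacian_flow L x \<and> x 0 = x0 \<longrightarrow>
              (\<forall>t\<ge>0. \<exists>i. x t $ i * x 0 $ i > 0)))
         \<longleftrightarrow> EP_matrix L"
proof
  assume flows: "\<forall>x0. x0 \<noteq> 0 \<longrightarrow> (\<forall>x. Laplacian_flow L x \<and> x 0 = x0 \<longrightarrow>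
    (\<forall>t\<ge>0. \<exists>i. x t $ i * x 0 $ i > 0))"
  show "EP_matrix L"
    unfolding EP_matrix_def
  proof (intro allI impI no_sign_reversal_imp_P_matrix)
    fix t :: real and y :: "real ^ 'n"
    assume "t \<ge> 0" "y \<noteq> 0"
    \<comment> \<open>This vector is the initial value of the solution through \<open>y\<close> at
      time \<open>t\<close>, and the assumption concerns nonzero initial values.\<close>
    then have "mat_exp (t *\<^sub>R L) *v y \<noteq> 0"
      using mat_exp_mult_vector_inverse[of t L y] by auto
    then show "\<exists>i. y $ i * (mat_exp (t *\<^sub>R L) *v y) $ i > 0"
      using flows Laplacian_flow_mat_exp[of L t y] \<open>t \<ge> 0\<close> by fastforce
  qed
next
  assume EP: "EP_matrix L"
  show "\<forall>x0. x0 \<noteq> 0 \<longrightarrow> (\<forall>x. Laplacian_flow L x \<and> x 0 = x0 \<longrightarrow>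
    (\<forall>t\<ge>0. \<exists>i. x t $ i * x 0 $ i > 0))"
  proof (intro allI impI)
    fix x0 x and t :: real
    assume "x0 \<noteq> 0" "Laplacian_flow L x \<and> x 0 = x0" "t \<ge> 0"
    \<comment> \<open>If \<open>x t\<close> were 0, the equation would give
      \<open>x 0 = 0\<close>.\<close>
    then have eq: "mat_exp (t *\<^sub>R L) *v x t = x 0" and "x t \<noteq> 0"
      using mat_exp_flow_eq_initial_value[of L x t] by auto
    then show "\<exists>i. x t $ i * x 0 $ i > 0"
      using EP P_matrix_imp_no_sign_reversal[of "mat_exp (t *\<^sub>R L)" "x t"] \<open>t \<ge> 0\<close>
      by (simp add: EP_matrix_def)
  qed
qed

end
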